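(* Suppose single-shot Tendermint, with lock timeout function $F_l$, is run with the FastSync synchronizer with timeout function $F$. Assume that $S_{\rm first}\ge\mathsf{GST}$, $F_l(1)>2\delta+2\Theta$, $F(1)>2\delta+3\Theta$ and $\mathsf{leader}(1)$ is correct. Then all correct processes decide no later than $S_{\rm last}+\delta+3\Theta$.
   Context: Model. There are $n=3f+1$ processes $p_1,\dots,p_n$, at most $f$ of which are faulty (Byzantine, behaving arbitrarily); the others are correct. A quorum is a set of $2f+1$ processes. Processes communicate over authenticated point-to-point links. Partial synchrony: there are a time $\mathsf{GST}$ and a bound $\delta$, both unknown to the protocol, such that after $\mathsf{GST}$ messages between correct processes are delayed by at most $\delta$; before $\mathsf{GST}$ messages may be arbitrarily delayed or lost (self-addressed messages are never lost). Local clocks may drift unboundedly before $\mathsf{GST}$ and do not drift from real time after it. Local processing takes zero time. $\langle m\rangle_i$ denotes a message $m$ of $p_i$ (authenticated); $\mathsf{hash}$ is collision-resistant (idealized as perfect). Each correct process has a proposal $\mathtt{myval}()$ satisfying a given predicate $\mathsf{valid}$. Reliable broadcast. Tendermint processes use a primitive "broadcast" guaranteeing that if a correct process receives a message $m$ by time $t$, then all correct processes receive $m$ by $\max\{t,\mathsf{GST}\}+\Theta$; in particular, a message broadcast by a correct process at time $t\ge\mathsf{GST}$ is received by all correct processes by $t+\Theta$. Synchronizer. Views are $1,2,\dots$; $0$ denotes an invalid view. The synchronizer issues notifications $\mathtt{new\_view}(v)$ at each correct process, which then enters $v$ and stays in it until it enters another view. Each correct process eventually calls $\mathtt{start}()$;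 $S_{\rm first}$ and $S_{\rm last}$ are the earliest and latest times when a correct process does so. The timeout function $F:\{0,1,2,\dots\}\to\mathsf{Time}$ is monotone, $F(0)=0$, and for every $\theta$ there is $v$ with $F(v')>\theta$ for all $v'\ge v$. FastSync (code of $p_i$), with retransmission interval $\rho$. Each process has an array $\mathsf{max\_views}[1..n]$ and variables $\mathsf{view}$, $\mathsf{view}^+$, all initially $0$, and a timer $\mathsf{timer\_view}$, initially not enabled. "All" includes the sender. These messages are sent over point-to-point links. - $\mathtt{start}()$: if $\mathsf{view}^+=0$, send $\mathtt{WISH}(1)$ to all. - When $\mathsf{timer\_view}$ expires: send $\mathtt{WISH}(\max(\mathsf{view}+1,\mathsf{view}^+))$ to all. - Every $\rho$ units of local time: if $\mathsf{timer\_view}$ is enabled, send $\mathtt{WISH}(\mathsf{view}^+)$ to all; otherwise, if $\mathsf{max\_views}[i]>0$, send $\mathtt{WISH}(\max(\mathsf{view}+1,\mathsf{view}^+))$ to all. - When $\mathtt{WISH}(v)$ is received from $p_j$: let $prev=\mathsf{view}$, $prev^+=\mathsf{view}^+$. If $v>\mathsf{max\_views}[j]$, set $\mathsf{max\_views}[j]:=v$. Set $\mathsf{view}$ (resp. $\mathsf{view}^+$) to the largest value $u$ occurring in $\mathsf{max\_views}$ such that at least $2f+1$ (resp. $f+1$) entries are $\ge u$. If $\mathsf{view}^+=\mathsf{view}$ and $\mathsf{view}>prev$, restart $\mathsf{timer\_view}$ with duration $F(\mathsf{view})$ and issue $\mathtt{new\_view}(\mathsf{view})$. Finally, if $\mathsf{view}^+>prev^+$,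 send $\mathtt{WISH}(\mathsf{view}^+)$ to all. Single-shot Tendermint (code of $p_i$). $\mathsf{leader}(v)=p_{((v-1)\bmod n)+1}$. Variables $\mathsf{curr\_view},\mathsf{prepared\_view},\mathsf{locked\_view}$ are initially $0$; $\mathsf{curr\_val},\mathsf{prepared\_val},\mathsf{locked\_val},\mathsf{voted}$ are initially $\bot$; $\mathsf{timer\_lock}$ is a timer. A handler runs when its trigger and precondition hold; messages for views higher than the current one are buffered. 1. Upon $\mathtt{new\_view}(v)$: $\mathsf{curr\_view}:=v$; $\mathsf{voted}:=$ false; stop $\mathsf{timer\_lock}$ and start it with duration $F_l(v)$; if $p_i=\mathsf{leader}(v)$: if $\mathsf{prepared\_view}\ne0$, broadcast $\langle\mathtt{PROPOSE}(v,\mathsf{prepared\_val},\mathsf{prepared\_view})\rangle_i$, else broadcast $\langle\mathtt{PROPOSE}(v,\mathtt{myval}(),0)\rangle_i$. 2. When $m=\langle\mathtt{PROPOSE}(v,x,\_)\rangle_j$ is received, with $\mathsf{curr\_view}=v$, $\mathsf{voted}=$ false, SafeProposal$(m)$: $\mathsf{curr\_val}:=x$; $\mathsf{voted}:=$ true; broadcast $\langle\mathtt{PREPARED}(v,\mathsf{hash}(x))\rangle_i$. 3. When $\{\langle\mathtt{PREPARED}(v,h)\rangle_j\mid p_j\in Q\}$ is received for a quorum $Q$, with $\mathsf{curr\_view}=v$, $\mathsf{voted}=$ true, $\mathsf{hash}(\mathsf{curr\_val})=h$: $\mathsf{prepared\_val}:=\mathsf{curr\_val}$; $\mathsf{prepared\_view}:=v$;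 if $\mathsf{timer\_lock}$ has not expired: $\mathsf{locked\_view}:=v$; $\mathsf{locked\_val}:=\mathsf{curr\_val}$; broadcast $\langle\mathtt{COMMITTED}(v,h)\rangle_i$. 4. When $\{\langle\mathtt{COMMITTED}(v,h)\rangle_j\mid p_j\in Q\}$ is received for a quorum $Q$, with $\mathsf{curr\_view}=\mathsf{locked\_view}=v$, $\mathsf{hash}(\mathsf{curr\_val})=h$: decide $\mathsf{curr\_val}$. Predicates (evaluated at the receiving process): prepared$(v,h)$ iff messages $\{\langle\mathtt{PREPARED}(v,h)\rangle_j\mid p_j\in Q\}$ have been received for some quorum $Q$. SafeProposal$(\langle\mathtt{PROPOSE}(v,x,\_)\rangle_i)$ iff $p_i=\mathsf{leader}(v)$, $\mathsf{valid}(x)$, and ($\mathsf{locked\_view}\ne0$ implies that $x=\mathsf{locked\_val}$ or there is $v'$ with $v>v'>\mathsf{locked\_view}$ and prepared$(v',\mathsf{hash}(x))$). *)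

theory Defs
  imports Complex_Main
begin

type_synonym proc = nat
type_synonym view = nat

text \<open>
  \<open>timeout\<close> is the timeout function $F$ of the synchronizer, \<open>lock_timeout\<close> is $F_l$,
  and \<open>rtx_interval\<close> is the retransmission interval $\rho$.
\<close>

record ('v, 'h) config =
  max_faulty :: nat
  timeout :: "view \<Rightarrow> real"
  lock_timeout :: "view \<Rightarrow> real"
  rtx_interval :: real
  hash :: "'v \<Rightarrow> 'h"
  valid :: "'v \<Rightarrow> bool"
  myval :: "proc \<Rightarrow> 'v"

definition procs :: "('v, 'h) config \<Rightarrow> proc set" where
  "procs C = {1..3 * max_faulty C + 1}"

definition quorum :: "('v, 'h) config \<Rightarrow> proc set \<Rightarrow> bool" where
  "quorum C Q \<longleftrightarrow> Q \<subseteq> procs C \<and> card Q = 2 * max_faulty C + 1"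

definition leader :: "('v, 'h) config \<Rightarrow> view \<Rightarrow> proc" where
  "leader C v = (v - 1) mod (3 * max_faulty C + 1) + 1"

text \<open>Injectivity of \<open>hash\<close> is the idealization of collision resistance.\<close>

definition wf_config :: "('v, 'h) config \<Rightarrow> bool" where
  "wf_config C \<longleftrightarrow>
     mono (timeout C) \<and> timeout C 0 = 0 \<and>
     (\<forall>\<theta>. \<exists>v. \<forall>v'\<ge>v. \<theta> < timeout C v') \<and>
     0 < rtx_interval C \<and> inj (hash C)"

datatype ('v, 'h) msg =
    Propose view 'v view
  | Prepared view 'h
  | Committed view 'h

text \<open>
  \<open>Recv j m\<close> is the receipt of the message \<open>m\<close> authenticated by \<open>j\<close> (whoever transmits it).
  A \<open>new_view\<close> notification is not an action of its own: it is handled within the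
  \<open>Recv_Wish\<close> step that triggers it.  The last three actions are runs of the Tendermint
  handlers for the messages \<open>PROPOSE\<close>, \<open>PREPARED\<close> and \<open>COMMITTED\<close> with the given contents.
\<close>

datatype ('v, 'h) action =
    Start
  | Timer_View_Expires
  | Retransmit
  | Recv_Wish proc view
  | Recv proc "('v, 'h) msg"
  | On_Propose proc view 'v view
  | On_Prepared view 'h
  | On_Committed view 'h

fun is_handler :: "('v, 'h) action \<Rightarrow> bool" where
  "is_handler (On_Propose j v x u) = True"
| "is_handler (On_Prepared v h) = True"
| "is_handler (On_Committed v h) = True"
| "is_handler a = False"

text \<open>
  Timers hold the local clock value at which they expire.  \<open>timer_view\<close> is \<open>None\<close> when it is
  not enabled; \<open>next_rtx\<close> is the local time of the next periodic retransmission.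
  In \<open>curr_val\<close>, \<open>prepared_val\<close>, \<open>locked_val\<close> and \<open>voted\<close>, the value \<open>None\<close> stands for
  $\bot$.  \<open>received\<close> buffers every Tendermint message ever received, together with its author.
\<close>

record ('v, 'h) local_state =
  max_views :: "proc \<Rightarrow> view"
  view :: view
  view_plus :: view
  timer_view :: "real option"
  next_rtx :: real
  curr_view :: view
  prepared_view :: view
  locked_view :: view
  curr_val :: "'v option"
  prepared_val :: "'v option"
  locked_val :: "'v option"
  voted :: "bool option"
  timer_lock :: "real option"
  received :: "(proc \<times> ('v, 'h) msg) set"

definition init_state :: "real \<Rightarrow> ('v, 'h) local_state" where
  "init_state r =
     \<lparr>max_views = (\<lambda>_. 0), view = 0, view_plus = 0, timer_view = None, next_rtx = r,
      curr_view = 0, prepared_view = 0, locked_view = 0,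
      curr_val = None, prepared_val = None, locked_val = None, voted = None,
      timer_lock = None, received = {}\<rparr>"

definition received_from_quorum ::
    "('v, 'h) config \<Rightarrow> ('v, 'h) local_state \<Rightarrow> ('v, 'h) msg \<Rightarrow> bool" where
  "received_from_quorum C s m \<longleftrightarrow> (\<exists>Q. quorum C Q \<and> (\<forall>j\<in>Q. (j, m) \<in> received s))"

definition prepared :: "('v, 'h) config \<Rightarrow> ('v, 'h) local_state \<Rightarrow> view \<Rightarrow> 'h \<Rightarrow> bool" where
  "prepared C s v h \<longleftrightarrow> received_from_quorum C s (Prepared v h)"

definition safe_proposal ::
    "('v, 'h) config \<Rightarrow> ('v, 'h) local_state \<Rightarrow> proc \<Rightarrow> view \<Rightarrow> 'v \<Rightarrow> bool" where
  "safe_proposal C s j v x \<longleftrightarrow>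
     j = leader C v \<and> valid C x \<and>
     (locked_view s \<noteq> 0 \<longrightarrow>
        Some x = locked_val s \<or>
        (\<exists>v'. locked_view s < v' \<and> v' < v \<and> prepared C s v' (hash C x)))"

text \<open>
  Below, \<open>c\<close> is the reading of the local clock at the time of the step.
\<close>

fun enabled :: "('v, 'h) config \<Rightarrow> real \<Rightarrow> ('v, 'h) local_state \<Rightarrow> ('v, 'h) action \<Rightarrow> bool" where
  "enabled C c s Start \<longleftrightarrow> True"
| "enabled C c s Timer_View_Expires \<longleftrightarrow> timer_view s = Some c"
| "enabled C c s Retransmit \<longleftrightarrow> next_rtx s = c"
| "enabled C c s (Recv_Wish j v) \<longleftrightarrow> j \<in> procs C"
| "enabled C c s (Recv j m) \<longleftrightarrow> j \<in> procs C"
| "enabled C c s (On_Propose j v x u) \<longleftrightarrow>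
     (j, Propose v x u) \<in> received s \<and> curr_view s = v \<and> voted s = Some False \<and>
     safe_proposal C s j v x"
| "enabled C c s (On_Prepared v h) \<longleftrightarrow>
     received_from_quorum C s (Prepared v h) \<and> curr_view s = v \<and> voted s = Some True \<and>
     map_option (hash C) (curr_val s) = Some h"
| "enabled C c s (On_Committed v h) \<longleftrightarrow>
     received_from_quorum C s (Committed v h) \<and> curr_view s = v \<and> locked_view s = v \<and>
     map_option (hash C) (curr_val s) = Some h"

definition largest_view :: "('v, 'h) config \<Rightarrow> nat \<Rightarrow> (proc \<Rightarrow> view) \<Rightarrow> view" where
  "largest_view C m mv =
     Max {u \<in> mv ` procs C. m \<le> card {j \<in> procs C. u \<le> mv j}}"

text \<open>
  The following functions take the process, its clock reading and its state.  They return the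
  new state, the view \<open>v\<close> such that \<open>WISH(v)\<close> is sent to all processes (if any), and the
  Tendermint message that is broadcast (if any).
\<close>

definition on_new_view ::
    "('v, 'h) config \<Rightarrow> proc \<Rightarrow> real \<Rightarrow> view \<Rightarrow> ('v, 'h) local_state \<Rightarrow>
     ('v, 'h) local_state \<times> ('v, 'h) msg option" where
  "on_new_view C p c v s =
     (s\<lparr>curr_view := v, voted := Some False, timer_lock := Some (c + lock_timeout C v)\<rparr>,
      if p = leader C v
      then Some (if prepared_view s \<noteq> 0
                 then Propose v (the (prepared_val s)) (prepared_view s)
                 else Propose v (myval C p) 0)
      else None)"

definition on_wish ::
    "('v, 'h) config \<Rightarrow> proc \<Rightarrow> real \<Rightarrow> proc \<Rightarrow> view \<Rightarrow> ('v, 'h) local_state \<Rightarrow>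
     ('v, 'h) local_state \<times> view option \<times> ('v, 'h) msg option" where
  "on_wish C p c j v s =
     (let mv = (if v > max_views s j then (max_views s)(j := v) else max_views s);
          w = largest_view C (2 * max_faulty C + 1) mv;
          w_plus = largest_view C (max_faulty C + 1) mv;
          s1 = s\<lparr>max_views := mv, view := w, view_plus := w_plus\<rparr>;
          (s2, b) =
            (if w_plus = w \<and> w > view s
             then on_new_view C p c w (s1\<lparr>timer_view := Some (c + timeout C w)\<rparr>)
             else (s1, None))
      in (s2, if w_plus > view_plus s then Some w_plus else None, b))"

definition timer_lock_expired :: "real \<Rightarrow> ('v, 'h) local_state \<Rightarrow> bool" where
  "timer_lock_expired c s \<longleftrightarrow> (\<exists>d. timer_lock s = Some d \<and> d \<le> c)"

fun react ::
    "('v, 'h) config \<Rightarrow> proc \<Rightarrow> real \<Rightarrow> ('v, 'h) local_state \<Rightarrow> ('v, 'h) action \<Rightarrow>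
     ('v, 'h) local_state \<times> view option \<times> ('v, 'h) msg option" where
  "react C p c s Start = (s, if view_plus s = 0 then Some 1 else None, None)"
| "react C p c s Timer_View_Expires =
     (s\<lparr>timer_view := None\<rparr>, Some (max (view s + 1) (view_plus s)), None)"
| "react C p c s Retransmit =
     (s\<lparr>next_rtx := c + rtx_interval C\<rparr>,
      if timer_view s \<noteq> None then Some (view_plus s)
      else if max_views s p > 0 then Some (max (view s + 1) (view_plus s))
      else None,
      None)"
| "react C p c s (Recv_Wish j v) = on_wish C p c j v s"
| "react C p c s (Recv j m) = (s\<lparr>received := insert (j, m) (received s)\<rparr>, None, None)"
| "react C p c s (On_Propose j v x u) =
     (s\<lparr>curr_val := Some x, voted := Some True\<rparr>, None, Some (Prepared v (hash C x)))"
| "react C p c s (On_Prepared v h) =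
     (let s1 = s\<lparr>prepared_val := curr_val s, prepared_view := v\<rparr>
      in if timer_lock_expired c s then (s1, None, None)
         else (s1\<lparr>locked_view := v, locked_val := curr_val s\<rparr>, None, Some (Committed v h)))"
| "react C p c s (On_Committed v h) = (s, None, None)"

text \<open>
  A run is a sequence of steps, ordered consistently with causality: step \<open>k\<close> is the action
  \<open>act k\<close> of process \<open>who k\<close>, taken at real time \<open>time k\<close>.  Several steps may happen at the
  same time.  \<open>state p k\<close> is the state of \<open>p\<close> before step \<open>k\<close>, and \<open>clock p t\<close> is the
  reading of the local clock of \<open>p\<close> at real time \<open>t\<close>.  The components are meaningful only for
  correct processes; steps of other processes play no role, and faulty behaviour shows up as
  unconstrained \<open>Recv_Wish\<close> and \<open>Recv\<close> steps of correct processes.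
\<close>

record ('v, 'h) run =
  correct :: "proc set"
  clock :: "proc \<Rightarrow> real \<Rightarrow> real"
  who :: "nat \<Rightarrow> proc"
  act :: "nat \<Rightarrow> ('v, 'h) action"
  time :: "nat \<Rightarrow> real"
  state :: "proc \<Rightarrow> nat \<Rightarrow> ('v, 'h) local_state"

definition takes :: "('v, 'h) run \<Rightarrow> nat \<Rightarrow> proc \<Rightarrow> ('v, 'h) action \<Rightarrow> bool" where
  "takes R k p a \<longleftrightarrow> who R k = p \<and> act R k = a"

definition outcome ::
    "('v, 'h) config \<Rightarrow> ('v, 'h) run \<Rightarrow> nat \<Rightarrow>
     ('v, 'h) local_state \<times> view option \<times> ('v, 'h) msg option" where
  "outcome C R k =
     (let p = who R k in react C p (clock R p (time R k)) (state R p k) (act R k))"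

definition sends_wish :: "('v, 'h) config \<Rightarrow> ('v, 'h) run \<Rightarrow> nat \<Rightarrow> proc \<Rightarrow> view \<Rightarrow> bool" where
  "sends_wish C R k p v \<longleftrightarrow> who R k = p \<and> fst (snd (outcome C R k)) = Some v"

definition broadcasts ::
    "('v, 'h) config \<Rightarrow> ('v, 'h) run \<Rightarrow> nat \<Rightarrow> proc \<Rightarrow> ('v, 'h) msg \<Rightarrow> bool" where
  "broadcasts C R k p m \<longleftrightarrow> who R k = p \<and> snd (snd (outcome C R k)) = Some m"

definition decides_at :: "('v, 'h) run \<Rightarrow> proc \<Rightarrow> 'v \<Rightarrow> real \<Rightarrow> bool" where
  "decides_at R p x t \<longleftrightarrow>
     (\<exists>k v h. takes R k p (On_Committed v h) \<and> curr_val (state R p k) = Some x \<and> time R k = t)"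

definition valid_steps :: "('v, 'h) config \<Rightarrow> ('v, 'h) run \<Rightarrow> bool" where
  "valid_steps C R \<longleftrightarrow>
     (\<forall>p\<in>correct R. \<exists>r. state R p 0 = init_state r) \<and>
     (\<forall>p\<in>correct R. \<forall>k.
        if who R k = p
        then enabled C (clock R p (time R k)) (state R p k) (act R k) \<and>
             state R p (Suc k) = fst (outcome C R k)
        else state R p (Suc k) = state R p k)"

text \<open>
  Time cannot pass beyond the deadline of a pending expiry or periodic retransmission.
  Together with \<open>enabled\<close>, this makes them happen exactly when the local clock reaches the
  deadline.
\<close>

definition timely_timers :: "('v, 'h) run \<Rightarrow> bool" where
  "timely_timers R \<longleftrightarrow>
     (\<forall>p\<in>correct R. \<forall>k.
        (\<forall>d. timer_view (state R p k) = Some d \<longrightarrow> clock R p (time R k) \<le> d) \<and>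
        clock R p (time R k) \<le> next_rtx (state R p k))"

text \<open>
  The trigger and the precondition of a handler may remain true after it has run.  The handler
  may then run again (which has no further effect besides repeating its output), but it is
  forced to run only once for the given contents.
\<close>

definition pending ::
    "('v, 'h) config \<Rightarrow> ('v, 'h) run \<Rightarrow> proc \<Rightarrow> nat \<Rightarrow> ('v, 'h) action \<Rightarrow> bool" where
  "pending C R p k a \<longleftrightarrow>
     is_handler a \<and> enabled C (clock R p (time R k)) (state R p k) a \<and>
     \<not> (\<exists>i<k. takes R i p a)"

text \<open>
  Local processing takes zero time: while a handler is pending at a process, time does not
  advance, and that process does nothing other than running pending handlers.
\<close>

definition zero_time_processing :: "('v, 'h) config \<Rightarrow> ('v, 'h) run \<Rightarrow> bool" where
  "zero_time_processing C R \<longleftrightarrow>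
     (\<forall>p\<in>correct R. \<forall>k. (\<exists>a. pending C R p (Suc k) a) \<longrightarrow>
        time R (Suc k) = time R k \<and>
        (who R (Suc k) = p \<longrightarrow> pending C R p (Suc k) (act R (Suc k))))"

definition authenticated :: "('v, 'h) config \<Rightarrow> ('v, 'h) run \<Rightarrow> bool" where
  "authenticated C R \<longleftrightarrow>
     (\<forall>p\<in>correct R. \<forall>j\<in>correct R. \<forall>k.
        (\<forall>v. takes R k p (Recv_Wish j v) \<longrightarrow> (\<exists>i<k. sends_wish C R i j v)) \<and>
        (\<forall>m. takes R k p (Recv j m) \<longrightarrow> (\<exists>i<k. broadcasts C R i j m)))"

definition tendermint_fastsync_run :: "('v, 'h) config \<Rightarrow> ('v, 'h) run \<Rightarrow> bool" where
  "tendermint_fastsync_run C R \<longleftrightarrow>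
     correct R \<subseteq> procs C \<and> card (procs C - correct R) \<le> max_faulty C \<and>
     (\<forall>p\<in>correct R. valid C (myval C p)) \<and>
     mono (time R) \<and> filterlim (time R) at_top sequentially \<and>
     (\<forall>p\<in>correct R. \<exists>!k. takes R k p Start) \<and>
     valid_steps C R \<and> timely_timers R \<and> zero_time_processing C R \<and> authenticated C R"

definition start_times :: "('v, 'h) run \<Rightarrow> real set" where
  "start_times R = {time R k | k p. p \<in> correct R \<and> takes R k p Start}"

definition S_first :: "('v, 'h) run \<Rightarrow> real" where
  "S_first R = Min (start_times R)"

definition S_last :: "('v, 'h) run \<Rightarrow> real" where
  "S_last R = Max (start_times R)"

text \<open>
  Nothing is required about messages sent before \<open>GST\<close>, except that those that a process
  sends to itself are not lost.
\<close>

definition partial_synchrony ::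
    "('v, 'h) config \<Rightarrow> ('v, 'h) run \<Rightarrow> real \<Rightarrow> real \<Rightarrow> bool" where
  "partial_synchrony C R GST \<delta> \<longleftrightarrow>
     0 \<le> \<delta> \<and>
     (\<forall>p\<in>correct R. strict_mono (clock R p) \<and> continuous_on UNIV (clock R p) \<and>
        (\<forall>t\<ge>GST. clock R p t = clock R p GST + (t - GST))) \<and>
     (\<forall>p\<in>correct R. \<forall>q\<in>correct R. \<forall>k v. sends_wish C R k p v \<and> GST \<le> time R k \<longrightarrow>
        (\<exists>i>k. takes R i q (Recv_Wish p v) \<and> time R i \<le> time R k + \<delta>)) \<and>
     (\<forall>p\<in>correct R. \<forall>k v. sends_wish C R k p v \<longrightarrow> (\<exists>i>k. takes R i p (Recv_Wish p v)))"

definition reliable_broadcast ::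
    "('v, 'h) config \<Rightarrow> ('v, 'h) run \<Rightarrow> real \<Rightarrow> real \<Rightarrow> bool" where
  "reliable_broadcast C R GST \<Theta> \<longleftrightarrow>
     0 \<le> \<Theta> \<and>
     (\<forall>p\<in>correct R. \<forall>q\<in>correct R. \<forall>j k m. takes R k p (Recv j m) \<longrightarrow>
        (\<exists>i. takes R i q (Recv j m) \<and> time R i \<le> max (time R k) GST + \<Theta>)) \<and>
     (\<forall>p\<in>correct R. \<forall>q\<in>correct R. \<forall>k m. broadcasts C R k p m \<and> GST \<le> time R k \<longrightarrow>
        (\<exists>i. takes R i q (Recv p m) \<and> time R i \<le> time R k + \<Theta>))"

end

theory Submission
  imports Defs
begin

text \<open>
  Let \<open>t\<close> be the time when the first correct process enters view 1.  By then \<open>f + 1\<close> correct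
  processes have sent \<open>WISH(1)\<close>, so by \<open>t + \<delta>\<close> every correct process has sent \<open>WISH(1)\<close> and by
  \<open>t + 2 \<delta>\<close> every correct process is in view 1; since all of them send \<open>WISH(1)\<close> by \<open>S_last\<close>, they
  are also there by \<open>S_last + \<delta>\<close>.  A correct process wishes for view 2 only after a timer of view 1
  has expired, hence not before \<open>t + F(1) > t + 2 \<delta> + 3 \<Theta>\<close>, which leaves time for the three
  broadcast rounds of view 1.  No correct process is locked at the start of view 1, so all accept
  the proposal of the correct leader, and \<open>F\<^sub>l(1)\<close> is long enough for all of them to lock.
\<close>

subsection \<open>Local steps\<close>

lemma finite_procs [simp]: "finite (procs C)"
  by (simp add: procs_def)

lemma card_procs [simp]: "card (procs C) = 3 * max_faulty C + 1"
  by (simp add: procs_def)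

text \<open>The least of the entries that are at least \<open>u\<close> is itself an entry, and at
  least as many processes reach it as reach \<open>u\<close>. So the restriction to occurring values
  loses nothing, and the \<open>Max\<close> becomes a count. The upper bound on \<open>m\<close>
  makes the set nonempty, taking 0 as threshold.\<close>

lemma le_largest_view_iff:
  assumes "1 \<le> m" "m \<le> 3 * max_faulty C + 1"
  shows "u \<le> largest_view C m mv \<longleftrightarrow> m \<le> card {j \<in> procs C. u \<le> mv j}"
proof -
  let ?A = "{u \<in> mv ` procs C. m \<le> card {j \<in> procs C. u \<le> mv j}}"
  have fin: "finite ?A"
    by simp
  have attained: "\<exists>u'\<in>?A. u \<le> u'" if "m \<le> card {j \<in> procs C. u \<le> mv j}" for u
  proof -
    let ?S = "{j \<in> procs C. u \<le> mv j}"
    have S: "finite ?S" "?S \<noteq> {}"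
      using that assms(1) card_gt_0_iff[of ?S] by simp_all
    then have u': "Min (mv ` ?S) \<in> mv ` ?S"
      by (intro Min_in) auto
    have "?S \<subseteq> {j \<in> procs C. Min (mv ` ?S) \<le> mv j}"
      using S by auto
    then have "card ?S \<le> card {j \<in> procs C. Min (mv ` ?S) \<le> mv j}"
      by (intro card_mono) auto
    then have "Min (mv ` ?S) \<in> ?A"
      using u' that by auto
    moreover have "u \<le> Min (mv ` ?S)"
      using u' by auto
    ultimately show ?thesis
      by blast
  qed
  have ne: "?A \<noteq> {}"
    using attained[of 0] assms(2) by auto
  show ?thesis
  proof
    assume le: "u \<le> largest_view C m mv"
    have "Max ?A \<in> ?A"
      using fin ne by (rule Max_in)
    then have "m \<le> card {j \<in> procs C. largest_view C m mv \<le> mv j}"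
      by (simp add: largest_view_def)
    also have "\<dots> \<le> card {j \<in> procs C. u \<le> mv j}"
      using le by (intro card_mono) auto
    finally show "m \<le> card {j \<in> procs C. u \<le> mv j}" .
  next
    assume "m \<le> card {j \<in> procs C. u \<le> mv j}"
    then obtain u' where "u' \<in> ?A" "u \<le> u'"
      using attained by blast
    then have "u \<le> Max ?A"
      using Max_ge[OF fin] order_trans by blast
    then show "u \<le> largest_view C m mv"
      by (simp add: largest_view_def)
  qed
qed

lemma largest_view_antimono:
  assumes "1 \<le> m" "m \<le> m'" "m' \<le> 3 * max_faulty C + 1"
  shows "largest_view C m' mv \<le> largest_view C m mv"
  using le_largest_view_iff[of m' C "largest_view C m' mv" mv]
    le_largest_view_iff[of m C "largest_view C m' mv" mv] assms
  by simp

lemma on_wish_views: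
  "max_views (fst (on_wish C p c j v s)) = (max_views s)(j := max (max_views s j) v)"
  "view (fst (on_wish C p c j v s)) =
     largest_view C (2 * max_faulty C + 1) (max_views (fst (on_wish C p c j v s)))"
  "view_plus (fst (on_wish C p c j v s)) =
     largest_view C (max_faulty C + 1) (max_views (fst (on_wish C p c j v s)))"
  "received (fst (on_wish C p c j v s)) = received s"
  unfolding on_wish_def on_new_view_def Let_def
  by (cases "max_views s j < v"; simp add: max_def split: if_split del: fun_upd_apply)+

lemma react_max_views:
  "max_views (fst (react C p c s a)) =
     (case a of Recv_Wish j v \<Rightarrow> (max_views s)(j := max (max_views s j) v) | _ \<Rightarrow> max_views s)"
  by (cases a) (simp_all add: on_wish_views Let_def del: fun_upd_apply)

lemma react_view:
  "view (fst (react C p c s a)) =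
     (case a of Recv_Wish j v \<Rightarrow>
        largest_view C (2 * max_faulty C + 1) (max_views (fst (react C p c s a)))
      | _ \<Rightarrow> view s)"
  by (cases a) (simp_all add: on_wish_views(2) Let_def)

lemma react_view_plus:
  "view_plus (fst (react C p c s a)) =
     (case a of Recv_Wish j v \<Rightarrow>
        largest_view C (max_faulty C + 1) (max_views (fst (react C p c s a)))
      | _ \<Rightarrow> view_plus s)"
  by (cases a) (simp_all add: on_wish_views(3) Let_def)

lemma react_received:
  "received (fst (react C p c s a)) =
     (case a of Recv j m \<Rightarrow> insert (j, m) (received s) | _ \<Rightarrow> received s)"
  by (cases a) (simp_all add: on_wish_views(4) Let_def)

lemma on_wish_sends:
  "fst (snd (on_wish C p c j v s)) =
     (let w = view_plus (fst (on_wish C p c j v s)) in if view_plus s < w then Some w else None)"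
  by (auto simp: on_wish_def on_new_view_def Let_def)

lemma on_wish_same_view:
  assumes "\<not> view s < view (fst (on_wish C p c j v s))"
  obtains mv w w' where "fst (on_wish C p c j v s) = s\<lparr>max_views := mv, view := w, view_plus := w'\<rparr>"
  using that assms by (auto simp: on_wish_def on_new_view_def Let_def split: if_splits)

lemma on_wish_new_view:
  fixes s s' :: "('v, 'h) local_state"
  assumes "s' = fst (on_wish C p c j v s)" "view s < view s'" "view_plus s' = view s'"
  shows "timer_view s' = Some (c + timeout C (view s'))"
    and "timer_lock s' = Some (c + lock_timeout C (view s'))"
    and "curr_view s' = view s'" "voted s' = Some False"
    and "prepared_view s' = prepared_view s" "locked_view s' = locked_view s"
    and "p = leader C (view s') \<Longrightarrow> prepared_view s = 0 \<Longrightarrow>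
      snd (snd (on_wish C p c j v s)) = Some (Propose (view s') (myval C p) 0)"
  using assms by (auto simp: on_wish_def on_new_view_def Let_def split: if_splits)

lemma on_wish_broadcasts:
  assumes "snd (snd (on_wish C p c j v s)) = Some m"
  shows "view s < view (fst (on_wish C p c j v s))"
    and "view_plus (fst (on_wish C p c j v s)) = view (fst (on_wish C p c j v s))"
    and "p = leader C (view (fst (on_wish C p c j v s)))"
  using assms by (auto simp: on_wish_def on_new_view_def Let_def split: if_splits)

text \<open>Entering a view resets \<open>voted\<close> to \<open>Some False\<close>, and only the
  \<open>PROPOSE\<close> handler sets it to \<open>Some True\<close> or writes
  \<open>curr_val\<close>. So a vote seen after any other step was already there, with the same
  value.\<close>

lemma react_voted:
  assumes "voted (fst (react C p c s a)) = Some True" "\<And>j v x u. a \<noteq> On_Propose j v x u"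
  shows "voted s = Some True" "curr_val (fst (react C p c s a)) = curr_val s"
  using assms
  by (cases a; auto simp: on_wish_def on_new_view_def Let_def split: if_splits)+

lemma react_locked_view:
  "locked_view (fst (react C p c s a)) =
     (case a of On_Prepared v h \<Rightarrow> if timer_lock_expired c s then locked_view s else v
      | _ \<Rightarrow> locked_view s)"
  by (cases a) (simp_all add: on_wish_def on_new_view_def Let_def)

subsection \<open>Steps of a run\<close>

locale tendermint_run =
  fixes C :: "('v, 'h) config" and R :: "('v, 'h) run" and GST \<delta> \<Theta> :: real
  assumes run: "tendermint_fastsync_run C R"
    and synchrony: "partial_synchrony C R GST \<delta>"
    and broadcast: "reliable_broadcast C R GST \<Theta>"
    and start_after_GST: "GST \<le> S_first R"
begin

lemma delay_nonneg: "0 \<le> \<delta>" "0 \<le> \<Theta>"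
  using synchrony broadcast by (auto simp: partial_synchrony_def reliable_broadcast_def)

lemma correct_procs: "correct R \<subseteq> procs C"
  using run by (simp add: tendermint_fastsync_run_def)

lemma finite_correct: "finite (correct R)"
  using correct_procs finite_procs by (rule finite_subset)

lemma card_faulty: "card (procs C - correct R) \<le> max_faulty C"
  using run by (simp add: tendermint_fastsync_run_def)

lemma card_correct: "2 * max_faulty C + 1 \<le> card (correct R)"
  using card_faulty card_Diff_subset[OF finite_correct correct_procs] by simp

lemma time_mono: "i \<le> k \<Longrightarrow> time R i \<le> time R k"
  using run by (simp add: tendermint_fastsync_run_def monoD)

lemma init: "p \<in> correct R \<Longrightarrow> \<exists>r. state R p 0 = init_state r"
  using run by (simp add: tendermint_fastsync_run_def valid_steps_def)

lemma idle: "p \<in> correct R \<Longrightarrow> who R k \<noteq> p \<Longrightarrow> state R p (Suc k) = state R p k"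
  using run by (simp add: tendermint_fastsync_run_def valid_steps_def)

lemma step:
  assumes "p \<in> correct R" "who R k = p"
  shows "enabled C (clock R p (time R k)) (state R p k) (act R k)"
    and "state R p (Suc k) = fst (react C p (clock R p (time R k)) (state R p k) (act R k))"
  using run assms
  by (auto simp: tendermint_fastsync_run_def valid_steps_def outcome_def Let_def)

lemma max_views_Suc:
  assumes "p \<in> correct R" "who R k = p"
  shows "max_views (state R p (Suc k)) =
      (case act R k of Recv_Wish j v \<Rightarrow>
         (max_views (state R p k))(j := max (max_views (state R p k) j) v)
       | _ \<Rightarrow> max_views (state R p k))"
  by (subst step(2)[OF assms]) (rule react_max_views)

lemma received_Suc:
  assumes "p \<in> correct R" "who R k = p"
  shows "received (state R p (Suc k)) =
      (case act R k of Recv j m \<Rightarrow> insert (j, m) (received (state R p k))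
       | _ \<Rightarrow> received (state R p k))"
  by (subst step(2)[OF assms]) (rule react_received)

lemma views_Suc:
  assumes "p \<in> correct R" "who R k = p"
  shows "view (state R p (Suc k)) =
      (case act R k of Recv_Wish j v \<Rightarrow>
         largest_view C (2 * max_faulty C + 1) (max_views (state R p (Suc k)))
       | _ \<Rightarrow> view (state R p k))"
    and "view_plus (state R p (Suc k)) =
      (case act R k of Recv_Wish j v \<Rightarrow>
         largest_view C (max_faulty C + 1) (max_views (state R p (Suc k)))
       | _ \<Rightarrow> view_plus (state R p k))"
  unfolding step(2)[OF assms] by (simp_all only: react_view[symmetric] react_view_plus[symmetric])

section \<open>Real time and step indices\<close>

lemma clock_after_GST:
  "p \<in> correct R \<Longrightarrow> GST \<le> t \<Longrightarrow> clock R p t = clock R p GST + (t - GST)"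
  using synchrony unfolding partial_synchrony_def by blast

text \<open>As times are monotone, this counts the steps taken up to time \<open>T\<close>, and
  \<open>state R p (steps_by T)\<close> is the state once everything that happens at time
  \<open>T\<close> is done. It turns real-time deadlines into step indices.\<close>

definition steps_by :: "real \<Rightarrow> nat" where
  "steps_by T = (LEAST k. T < time R k)"

lemma less_steps_by: "i < steps_by T \<longleftrightarrow> time R i \<le> T"
proof
  show "i < steps_by T \<Longrightarrow> time R i \<le> T"
    unfolding steps_by_def by (drule not_less_Least) simp
  have "filterlim (time R) at_top sequentially"
    using run by (simp add: tendermint_fastsync_run_def)
  then have "\<exists>k. T < time R k"
    unfolding filterlim_at_top_dense eventually_sequentially by blast
  then have "T < time R (steps_by T)"
    unfolding steps_by_def by (rule LeastI_ex)
  then show "time R i \<le> T \<Longrightarrow> i < steps_by T"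
    using time_mono[of "steps_by T" i] by linarith
qed

lemma steps_by_mono: "T \<le> T' \<Longrightarrow> steps_by T \<le> steps_by T'"
  using less_steps_by[of "steps_by T'" T] less_steps_by[of "steps_by T'" T']
  by (meson not_le order_less_irrefl order_trans)

text \<open>Otherwise the handler would be pending at a step at which time advances.\<close>

lemma handler_ran:
  assumes "p \<in> correct R" "is_handler a" "time R 0 \<le> T"
    and en: "\<And>c. enabled C c (state R p (steps_by T)) a"
  obtains i where "time R i \<le> T" "takes R i p a"
proof -
  obtain k where k: "steps_by T = Suc k"
    using assms(3) less_steps_by[of 0 T] by (cases "steps_by T") auto
  \<comment> \<open>Step \<open>k\<close> is the last one with time at most \<open>T\<close>, so
    time advances strictly to step \<open>Suc k\<close>.\<close>
  have "time R k \<noteq> time R (Suc k)"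
    using less_steps_by[of k T] less_steps_by[of "Suc k" T] k by auto
  moreover have "zero_time_processing C R"
    using run by (simp add: tendermint_fastsync_run_def)
  ultimately have "\<not> pending C R p (Suc k) a"
    using assms(1) unfolding zero_time_processing_def by metis
  then show ?thesis
    using that assms(2) en k by (metis pending_def less_steps_by)
qed

section \<open>Views, wishes and messages along a run\<close>

lemma state_views:
  assumes "p \<in> correct R"
  shows "view (state R p k) = largest_view C (2 * max_faulty C + 1) (max_views (state R p k)) \<and>
    view_plus (state R p k) = largest_view C (max_faulty C + 1) (max_views (state R p k))"
proof (induction k)
  case 0
  obtain r where "state R p 0 = init_state r"
    using init assms by blast
  moreover have "largest_view C m (\<lambda>_. 0) = 0" if "1 \<le> m" "m \<le> 3 * max_faulty C + 1" for m
    using le_largest_view_iff[OF that, of 1 "\<lambda>_. 0"] that by auto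
  ultimately show ?case
    by (simp add: init_state_def)
next
  case (Suc k)
  show ?case
  proof (cases "who R k = p")
    case True
    show ?thesis
      using Suc views_Suc[OF assms True] max_views_Suc[OF assms True]
      by (cases "act R k") (simp_all del: fun_upd_apply)
  qed (use Suc idle assms in auto)
qed

lemma le_view_iff:
  assumes "p \<in> correct R"
  shows "u \<le> view (state R p k) \<longleftrightarrow>
    2 * max_faulty C + 1 \<le> card {j \<in> procs C. u \<le> max_views (state R p k) j}"
  using state_views[OF assms, of k] by (simp add: le_largest_view_iff)

lemma le_view_plus_iff:
  assumes "p \<in> correct R"
  shows "u \<le> view_plus (state R p k) \<longleftrightarrow>
    max_faulty C + 1 \<le> card {j \<in> procs C. u \<le> max_views (state R p k) j}"
  using state_views[OF assms, of k] by (simp add: le_largest_view_iff)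

lemma view_le_view_plus: "p \<in> correct R \<Longrightarrow> view (state R p k) \<le> view_plus (state R p k)"
  using state_views[of p k] by (simp add: largest_view_antimono)

text \<open>At most \<open>f\<close> processes are faulty, so they cannot own all of the
  \<open>f + 1\<close> entries behind \<open>view_plus\<close>.\<close>

lemma view_plus_correct_wish:
  assumes "p \<in> correct R" "u \<le> view_plus (state R p k)"
  obtains j where "j \<in> correct R" "u \<le> max_views (state R p k) j"
proof -
  let ?A = "{j \<in> procs C. u \<le> max_views (state R p k) j}"
  have "\<not> ?A \<subseteq> procs C - correct R"
  proof
    assume "?A \<subseteq> procs C - correct R"
    then have "card ?A \<le> card (procs C - correct R)"
      by (intro card_mono) auto
    then show False
      using card_faulty assms le_view_plus_iff[of p u k] by simp
  qed
  then show ?thesis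
    using that by blast
qed

lemma max_views_mono:
  assumes "p \<in> correct R" "i \<le> k"
  shows "max_views (state R p i) j \<le> max_views (state R p k) j"
  using assms(2)
proof (induction k rule: dec_induct)
  case (step k)
  have "max_views (state R p k) j \<le> max_views (state R p (Suc k)) j"
  proof (cases "who R k = p")
    case True
    then show ?thesis
      using max_views_Suc[OF assms(1) True] by (cases "act R k") auto
  qed (use idle assms in auto)
  then show ?case
    using step.IH by linarith
qed simp

lemma view_mono:
  assumes "p \<in> correct R" "i \<le> k"
  shows "view (state R p i) \<le> view (state R p k)"
proof -
  have "2 * max_faulty C + 1 \<le> card {j \<in> procs C. view (state R p i) \<le> max_views (state R p i) j}"
    using le_view_iff[OF assms(1)] by blast
  also have "\<dots> \<le> card {j \<in> procs C. view (state R p i) \<le> max_views (state R p k) j}"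
    using max_views_mono[OF assms] by (intro card_mono) (auto intro: order_trans)
  finally show ?thesis
    using le_view_iff[OF assms(1)] by blast
qed

lemma received_mono:
  assumes "p \<in> correct R" "i \<le> k"
  shows "received (state R p i) \<subseteq> received (state R p k)"
  using assms(2)
proof (induction k rule: dec_induct)
  case (step k)
  have "received (state R p k) \<subseteq> received (state R p (Suc k))"
  proof (cases "who R k = p")
    case True
    then show ?thesis
      using received_Suc[OF assms(1) True] by (cases "act R k") auto
  qed (use idle assms in auto)
  then show ?case
    using step.IH by blast
qed simp

text \<open>An entry changes only on receipt of a larger wish from its owner, and authentication
  traces that receipt to an earlier sending. Positivity excludes the initial value.\<close>

lemma max_views_sent:
  assumes "p \<in> correct R" "j \<in> correct R" "0 < max_views (state R p k) j"
  shows "\<exists>i<k. sends_wish C R i j (max_views (state R p k) j)"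
  using assms(3)
proof (induction k)
  case 0
  then show ?case
    using init[OF assms(1)] by (auto simp: init_state_def)
next
  case (Suc k)
  show ?case
  proof (cases "max_views (state R p (Suc k)) j = max_views (state R p k) j")
    case True
    then show ?thesis
      using Suc less_Suc_eq by auto
  next
    case False
    then have who: "who R k = p"
      using idle assms(1) by metis
    have act: "act R k = Recv_Wish j (max_views (state R p (Suc k)) j)"
      using False max_views_Suc[OF assms(1) who]
      by (cases "act R k") (auto simp: max_def split: if_splits)
    have "authenticated C R"
      using run by (simp add: tendermint_fastsync_run_def)
    then show ?thesis
      using act who assms(1,2) unfolding authenticated_def takes_def by (metis less_SucI)
  qed
qed

lemma received_broadcast:
  assumes "p \<in> correct R" "j \<in> correct R" "(j, m) \<in> received (state R p k)"
  shows "\<exists>i<k. broadcasts C R i j m"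
  using assms(3)
proof (induction k)
  case 0
  then show ?case
    using init[OF assms(1)] by (auto simp: init_state_def)
next
  case (Suc k)
  show ?case
  proof (cases "(j, m) \<in> received (state R p k)")
    case True
    then show ?thesis
      using Suc less_Suc_eq by auto
  next
    case False
    then have who: "who R k = p"
      using idle assms(1) Suc.prems by metis
    have act: "act R k = Recv j m"
      using False Suc.prems received_Suc[OF assms(1) who]
      by (cases "act R k") auto
    have "authenticated C R"
      using run by (simp add: tendermint_fastsync_run_def)
    then show ?thesis
      using act who assms(1,2) unfolding authenticated_def takes_def by (metis less_SucI)
  qed
qed

section \<open>Delivery, own wishes and start times\<close>

lemma wish_delivered:
  assumes "p \<in> correct R" "q \<in> correct R" "sends_wish C R i p v" "GST \<le> time R i"
    and "time R i + \<delta> \<le> T"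
  shows "v \<le> max_views (state R q (steps_by T)) p"
proof -
  obtain k where k: "takes R k q (Recv_Wish p v)" "time R k \<le> time R i + \<delta>"
    using synchrony assms(1-4) unfolding partial_synchrony_def by metis
  have "v \<le> max_views (state R q (Suc k)) p"
    using k max_views_Suc[OF assms(2), of k] by (simp add: takes_def)
  also have "\<dots> \<le> max_views (state R q (steps_by T)) p"
    using k assms(5) by (intro max_views_mono assms(2) Suc_leI) (simp add: less_steps_by)
  finally show ?thesis .
qed

lemma broadcast_delivered:
  assumes "p \<in> correct R" "q \<in> correct R" "broadcasts C R i p m" "GST \<le> time R i"
    and "time R i + \<Theta> \<le> T"
  shows "(p, m) \<in> received (state R q (steps_by T))"
proof -
  obtain k where k: "takes R k q (Recv p m)" "time R k \<le> time R i + \<Theta>"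
    using broadcast assms(1-4) unfolding reliable_broadcast_def by metis
  have "(p, m) \<in> received (state R q (Suc k))"
    using k received_Suc[OF assms(2), of k] by (simp add: takes_def)
  moreover have "Suc k \<le> steps_by T"
    using k assms(5) by (intro Suc_leI) (simp add: less_steps_by)
  ultimately show ?thesis
    using received_mono[OF assms(2)] by blast
qed

lemma received_from_quorumI:
  assumes "\<And>j. j \<in> correct R \<Longrightarrow> (j, m) \<in> received s"
  shows "received_from_quorum C s m"
proof -
  obtain Q where "Q \<subseteq> correct R" "card Q = 2 * max_faulty C + 1"
    using obtain_subset_with_card_n[OF card_correct] by blast
  then show ?thesis
    using assms correct_procs unfolding received_from_quorum_def quorum_def by blast
qed

text \<open>The step at which \<open>view_plus\<close> leaves 0 itself sends a wish for the new
  value.\<close>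

lemma view_plus_sent:
  assumes "p \<in> correct R" "0 < view_plus (state R p k)"
  shows "\<exists>i<k. \<exists>v\<ge>1. sends_wish C R i p v"
  using assms(2)
proof (induction k)
  case 0
  then show ?case
    using init[OF assms(1)] by (auto simp: init_state_def)
next
  case (Suc k)
  show ?case
  proof (cases "0 < view_plus (state R p k)")
    case True
    then show ?thesis
      using Suc less_Suc_eq by blast
  next
    case False
    then have who: "who R k = p"
      using idle assms(1) Suc.prems by metis
    then have "sends_wish C R k p (view_plus (state R p (Suc k)))"
      using False Suc.prems step(2)[OF assms(1) who] views_Suc(2)[OF assms(1) who]
      by (cases "act R k") (simp_all add: sends_wish_def outcome_def on_wish_sends Let_def)
    then show ?thesis
      using Suc.prems by (intro exI[of _ k]) (auto simp: Suc_le_eq)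
  qed
qed

text \<open>\<open>Start\<close> is silent only if \<open>view_plus\<close> is already positive, and
  then an earlier wish exists.\<close>

lemma started_sent:
  assumes "p \<in> correct R" "takes R k p Start"
  shows "\<exists>i\<le>k. \<exists>v\<ge>1. sends_wish C R i p v"
proof (cases "0 < view_plus (state R p k)")
  case True
  then show ?thesis
    using view_plus_sent assms by (meson less_imp_le)
next
  case False
  then have "sends_wish C R k p 1"
    using assms by (simp add: sends_wish_def outcome_def takes_def)
  then show ?thesis
    by blast
qed

lemma correct_started: "p \<in> correct R \<Longrightarrow> \<exists>k. takes R k p Start"
  using run unfolding tendermint_fastsync_run_def by blast

text \<open>Each correct process starts exactly once, so start times are indexed by processes.
  Finiteness gives \<open>Min\<close> and \<open>Max\<close> in \<open>S_first\<close> and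
  \<open>S_last\<close> their intended meaning.\<close>

lemma finite_start_times: "finite (start_times R)"
proof (rule finite_subset)
  show "start_times R \<subseteq> (\<lambda>p. time R (THE k. takes R k p Start)) ` correct R"
  proof
    fix t
    assume "t \<in> start_times R"
    then obtain k p where k: "t = time R k" "p \<in> correct R" "takes R k p Start"
      unfolding start_times_def by blast
    have "\<exists>!k. takes R k p Start"
      using run k(2) unfolding tendermint_fastsync_run_def by blast
    then have "(THE k. takes R k p Start) = k"
      using k(3) by (rule the1_equality)
    then show "t \<in> (\<lambda>p. time R (THE k. takes R k p Start)) ` correct R"
      using k by blast
  qed
qed (use finite_correct in simp)

lemma start_time_bounds:
  assumes "p \<in> correct R" "takes R k p Start"
  shows "GST \<le> time R k" "time R k \<le> S_last R"
proof -
  have "time R k \<in> start_times R"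
    using assms unfolding start_times_def by blast
  then have "S_first R \<le> time R k" and le: "time R k \<le> S_last R"
    unfolding S_first_def S_last_def
    by (rule Min_le[OF finite_start_times], rule Max_ge[OF finite_start_times])
  then show "GST \<le> time R k"
    using start_after_GST by linarith
  show "time R k \<le> S_last R"
    by (rule le)
qed

subsection \<open>The first view\<close>

text \<open>With \<open>b = 1\<close> this says that no correct process has yet tried to leave view
  1; with \<open>b = 0\<close>, that none has wished at all.\<close>

definition wishes_at_most :: "view \<Rightarrow> nat \<Rightarrow> bool" where
  "wishes_at_most b k \<longleftrightarrow> (\<forall>i<k. \<forall>p\<in>correct R. \<forall>v. sends_wish C R i p v \<longrightarrow> v \<le> b)"

lemma wishes_at_most_antimono: "wishes_at_most b k \<Longrightarrow> i \<le> k \<Longrightarrow> wishes_at_most b i"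
  unfolding wishes_at_most_def by (meson less_le_trans)

lemma max_views_le:
  assumes "wishes_at_most b k" "p \<in> correct R" "j \<in> correct R"
  shows "max_views (state R p k) j \<le> b"
  using assms max_views_sent[OF assms(2,3), of k] unfolding wishes_at_most_def
  by (cases "max_views (state R p k) j = 0") auto

lemma view_plus_le:
  assumes "wishes_at_most b k" "p \<in> correct R"
  shows "view_plus (state R p k) \<le> b"
proof -
  obtain j where "j \<in> correct R" "view_plus (state R p k) \<le> max_views (state R p k) j"
    using view_plus_correct_wish[OF assms(2) order_refl] .
  then show ?thesis
    using max_views_le[OF assms] order_trans by blast
qed

lemma view_le: "wishes_at_most b k \<Longrightarrow> p \<in> correct R \<Longrightarrow> view (state R p k) \<le> b"
  using view_plus_le view_le_view_plus order_trans by blast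

text \<open>The bound on wishes before step \<open>k\<close> still controls the state after a
  receipt at step \<open>k\<close>, because a wish received from a correct process was sent earlier.
  This lets inductions pass through the receipt before step \<open>k\<close> itself is known to
  respect the bound.\<close>

lemma view_plus_after_wish:
  assumes "wishes_at_most b k" "p \<in> correct R" "who R k = p" "act R k = Recv_Wish j v"
  shows "view_plus (state R p (Suc k)) \<le> b"
proof -
  have "authenticated C R"
    using run by (simp add: tendermint_fastsync_run_def)
  then have "v \<le> b" if "j \<in> correct R"
    using that assms unfolding authenticated_def takes_def wishes_at_most_def by metis
  then have "max_views (state R p (Suc k)) i \<le> b" if "i \<in> correct R" for i
    using that max_views_le[OF assms(1,2) that] max_views_Suc[OF assms(2,3)] assms(4)
    by auto
  moreover obtain i where "i \<in> correct R"
    "view_plus (state R p (Suc k)) \<le> max_views (state R p (Suc k)) i"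
    using view_plus_correct_wish[OF assms(2) order_refl] .
  ultimately show ?thesis
    using order_trans by blast
qed

text \<open>
  The view entered is view 1 as long as no correct process has wished for a later one: then
  \<open>view_plus\<close> is at most 1, so it equals \<open>view\<close> when \<open>view\<close> becomes positive.
\<close>

definition enters :: "proc \<Rightarrow> nat \<Rightarrow> bool" where
  "enters p e \<longleftrightarrow>
     p \<in> correct R \<and> who R e = p \<and> view (state R p e) = 0 \<and> 0 < view (state R p (Suc e))"

definition before_entry :: "proc \<Rightarrow> nat \<Rightarrow> bool" where
  "before_entry p k \<longleftrightarrow>
     (let s = state R p k in
        view s = 0 \<and> timer_view s = None \<and> curr_view s = 0 \<and> voted s = None \<and>
        prepared_view s = 0 \<and> locked_view s = 0)"

text \<open>The entering step \<open>e\<close> is kept as a parameter because both timers run from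
  its clock reading. The final disjunction claims an absent lock and prepared value only until the
  vote; afterwards the \<open>PREPARED\<close> handler may set them.\<close>

definition in_first_view :: "proc \<Rightarrow> nat \<Rightarrow> nat \<Rightarrow> bool" where
  "in_first_view p e k \<longleftrightarrow>
     (let s = state R p k; c = clock R p (time R e) in
        e < k \<and> enters p e \<and> view s = 1 \<and> curr_view s = 1 \<and>
        timer_view s = Some (c + timeout C 1) \<and> timer_lock s = Some (c + lock_timeout C 1) \<and>
        (p = leader C 1 \<longrightarrow> broadcasts C R e p (Propose 1 (myval C p) 0)) \<and>
        (voted s = Some False \<and> locked_view s = 0 \<and> prepared_view s = 0 \<or>
         voted s = Some True))"

text \<open>While nobody wishes beyond view 1, a process is either untouched or in view 1 with both
  timers as set on entry. The clause on \<open>On_Propose\<close> is carried along because a handler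
  is forced to run only once: to force a vote later, it must be known that the handler did not run
  before.\<close>

lemma first_view_invariant:
  assumes "wishes_at_most 1 k" "p \<in> correct R"
  shows "(before_entry p k \<and> (\<forall>i<k. \<forall>j v x u. \<not> takes R i p (On_Propose j v x u))) \<or>
    (\<exists>e. in_first_view p e k \<and>
      (voted (state R p k) = Some False \<longrightarrow>
        (\<forall>i<k. \<forall>j v x u. \<not> takes R i p (On_Propose j v x u))))"
  using assms(1)
proof (induction k)
  case 0
  then show ?case
    using init[OF assms(2)] by (auto simp: init_state_def before_entry_def Let_def)
next
  case (Suc k)
  have le1: "wishes_at_most 1 k"
    using Suc.prems wishes_at_most_antimono by (meson le_SucI order_refl)
  note IH = Suc.IH[OF le1]
  show ?case
  proof (cases "who R k = p")
    case False
    then have "state R p (Suc k) = state R p k"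
      using idle assms(2) by blast
    then show ?thesis
      using IH False
      by (auto simp: before_entry_def in_first_view_def Let_def takes_def less_Suc_eq)
  next
    case True
    note st = step[OF assms(2) True]
    show ?thesis
    proof (cases "act R k")
      case (Recv_Wish j v)
      have vp: "view_plus (state R p (Suc k)) \<le> 1"
        using view_plus_after_wish[OF le1 assms(2) True Recv_Wish] .
      have v: "view (state R p (Suc k)) \<le> view_plus (state R p (Suc k))"
        using view_le_view_plus[OF assms(2)] .
      have mono: "view (state R p k) \<le> view (state R p (Suc k))"
        using view_mono[OF assms(2)] by simp
      have no: "\<not> takes R k p (On_Propose j v x u)" for j v x u
        using Recv_Wish by (simp add: takes_def)
      show ?thesis
      proof (cases "view (state R p k) < view (state R p (Suc k))")
        case True
        then have one: "view (state R p (Suc k)) = 1" "view_plus (state R p (Suc k)) = 1"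
          and zero: "view (state R p k) = 0"
          using vp v by auto
        then have fresh: "before_entry p k" "\<forall>i<k. \<forall>j v x u. \<not> takes R i p (On_Propose j v x u)"
          using IH by (auto simp: in_first_view_def Let_def)
        have ent: "enters p k"
          using one zero assms(2) \<open>who R k = p\<close> by (simp add: enters_def)
        have fst: "state R p (Suc k) = fst (on_wish C p (clock R p (time R k)) j v (state R p k))"
          using st(2) Recv_Wish by simp
        \<comment> \<open>Step \<open>k\<close> itself is the entering step. A leader proposes its
          own value here since \<open>prepared_view\<close> is still 0.\<close>
        have "in_first_view p k (Suc k)"
          using on_wish_new_view[OF fst] one zero fresh(1) Recv_Wish ent \<open>who R k = p\<close>
          unfolding in_first_view_def before_entry_def broadcasts_def outcome_def Let_def
          by auto
        then show ?thesis
          using fresh(2) no by (auto simp: less_Suc_eq)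
      next
        case False
        then have eq: "view (state R p (Suc k)) = view (state R p k)"
          using mono by simp
        have "\<not> view (state R p k) <
            view (fst (on_wish C p (clock R p (time R k)) j v (state R p k)))"
          using False st(2) Recv_Wish by simp
        then obtain mv w w' where
          s: "state R p (Suc k) = (state R p k)\<lparr>max_views := mv, view := w, view_plus := w'\<rparr>"
          by (rule on_wish_same_view) (use st(2) Recv_Wish in simp)
        then have "w = view (state R p k)"
          using eq by simp
        then show ?thesis
          using IH no unfolding before_entry_def in_first_view_def Let_def s
          by (auto simp: less_Suc_eq)
      qed
    next
      case Timer_View_Expires
      \<comment> \<open>An expiry wishes for at least \<open>view + 1\<close>, which in view 1 would
        break the bound; before entry the timer is off. So this case cannot occur.\<close>
      then have sends: "sends_wish C R k p (max (view (state R p k) + 1) (view_plus (state R p k)))"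
        using True by (simp add: sends_wish_def outcome_def)
      then have "view (state R p k) = 0"
        using Suc.prems assms(2) unfolding wishes_at_most_def by fastforce
      then show ?thesis
        using IH st(1) Timer_View_Expires
        by (auto simp: before_entry_def in_first_view_def Let_def)
    next
      case (On_Propose j v x u)
      then have "voted (state R p k) = Some False"
        using st(1) by simp
      then obtain e where "in_first_view p e k"
        using IH by (auto simp: before_entry_def Let_def)
      then have "in_first_view p e (Suc k)" "voted (state R p (Suc k)) = Some True"
        using st(2) On_Propose by (simp_all add: in_first_view_def Let_def)
      then show ?thesis
        by auto
    next
      case (On_Prepared v h)
      \<comment> \<open>The handler changes the prepared and possibly the locked view, but only
        after the vote, so the second disjunct of the invariant survives.\<close>
      then have voted: "voted (state R p k) = Some True"
        using st(1) by simp
      then obtain e where "in_first_view p e k"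
        using IH by (auto simp: before_entry_def Let_def)
      then have "in_first_view p e (Suc k)" "voted (state R p (Suc k)) = Some True"
        using st(2) On_Prepared voted by (simp_all add: in_first_view_def Let_def)
      then show ?thesis
        by auto
    qed (use IH st True in
        \<open>auto simp: before_entry_def in_first_view_def Let_def takes_def less_Suc_eq\<close>)
  qed
qed

section \<open>Timing of wishes and entries\<close>

lemma in_first_viewI:
  assumes "wishes_at_most 1 k" "p \<in> correct R" "0 < view (state R p k)"
  obtains e where "in_first_view p e k"
  using first_view_invariant[OF assms(1,2)] assms(3)
  unfolding before_entry_def Let_def by auto

lemma voted_in_first_view:
  assumes "wishes_at_most 1 k" "p \<in> correct R" "voted (state R p k) \<noteq> None"
  obtains e where "in_first_view p e k"
  using first_view_invariant[OF assms(1,2)] assms(3)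
  unfolding before_entry_def Let_def by auto

text \<open>Consider the very first wish of any correct process. Before it no timer is on, and at
  its sender neither its own entry of \<open>max_views\<close> nor \<open>view_plus\<close> is
  positive, so it can only come from \<open>Start\<close>, which happens after \<open>GST\<close>.
  All other wishes come later.\<close>

lemma wish_after_GST:
  assumes "p \<in> correct R" "sends_wish C R i p v" "1 \<le> v"
  shows "GST \<le> time R i"
proof -
  let ?P = "\<lambda>i. \<exists>p\<in>correct R. \<exists>v\<ge>1. sends_wish C R i p v"
  define k where "k = (LEAST i. ?P i)"
  have "?P i"
    using assms by blast
  then have "?P k" "k \<le> i"
    unfolding k_def by (rule LeastI, rule Least_le)
  then obtain q w where q: "q \<in> correct R" "1 \<le> w" "sends_wish C R k q w"
    by blast
  have none: "wishes_at_most 0 k"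
    unfolding wishes_at_most_def
  proof (intro allI ballI impI)
    fix i p v
    assume "i < k" "p \<in> correct R" "sends_wish C R i p v"
    then show "v \<le> 0"
      using not_less_Least[of i ?P] unfolding k_def by (metis One_nat_def Suc_leI not_le)
  qed
  then have "wishes_at_most 1 k"
    unfolding wishes_at_most_def by force
  moreover have zero: "view (state R q k) = 0" "view_plus (state R q k) = 0"
    using view_le[OF none q(1)] view_plus_le[OF none q(1)] by simp_all
  ultimately have "before_entry q k"
    using first_view_invariant[OF _ q(1), of k] by (auto simp: in_first_view_def Let_def)
  then have timer: "timer_view (state R q k) = None"
    by (simp add: before_entry_def Let_def)
  have who: "who R k = q"
    using q(3) by (simp add: sends_wish_def)
  have "act R k = Start"
  proof (cases "act R k")
    case Timer_View_Expires
    then show ?thesis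
      using step(1)[OF q(1) who] timer by simp
  next
    case Retransmit
    then show ?thesis
      using q max_views_le[OF none q(1) q(1)] timer
      by (auto simp: sends_wish_def outcome_def Let_def)
  next
    case (Recv_Wish j u)
    then show ?thesis
      using q zero view_plus_after_wish[OF none q(1) who Recv_Wish] step(2)[OF q(1) who]
      by (auto simp: sends_wish_def outcome_def on_wish_sends Let_def split: if_splits)
  qed (use q(3) in \<open>auto simp: sends_wish_def outcome_def Let_def split: if_splits\<close>)
  then have "GST \<le> time R k"
    using start_time_bounds(1) q(1) who by (simp add: takes_def)
  then show ?thesis
    using time_mono[OF \<open>k \<le> i\<close>] by linarith
qed

text \<open>A positive \<open>view\<close> forces a positive \<open>view_plus\<close>, hence an own
  wish. That wish may be sent by the entering step itself, whence the bound
  \<open>Suc e\<close>.\<close>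

lemma enters_after_GST:
  assumes "enters p e"
  shows "GST \<le> time R e"
proof -
  have p: "p \<in> correct R" "0 < view_plus (state R p (Suc e))"
    using assms view_le_view_plus[of p "Suc e"] by (auto simp: enters_def)
  then obtain i v where "i < Suc e" "1 \<le> v" "sends_wish C R i p v"
    using view_plus_sent by blast
  then show ?thesis
    using wish_after_GST p(1) time_mono[of i e] by fastforce
qed

lemma entered:
  assumes "p \<in> correct R" "0 < view (state R p k)"
  shows "\<exists>e<k. enters p e"
  using assms(2)
proof (induction k)
  case 0
  then show ?case
    using init[OF assms(1)] by (auto simp: init_state_def)
next
  case (Suc k)
  show ?case
  proof (cases "0 < view (state R p k)")
    case True
    then show ?thesis
      using Suc less_Suc_eq by blast
  next
    case False
    then have "who R k = p"
      using Suc.prems idle assms(1) by metis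
    then show ?thesis
      using False Suc.prems assms(1) unfolding enters_def by blast
  qed
qed

text \<open>For a first wish beyond view 1, \<open>Start\<close> sends only 1, a receipt sends
  \<open>view_plus\<close>, still at most 1, and a retransmission also sends at most 1:
  \<open>view_plus\<close> with the timer on, and \<open>view + 1 = 1\<close> before entry. Only an
  expiry of the timer set on entry remains.\<close>

lemma late_wish:
  assumes "wishes_at_most 1 k" "p \<in> correct R" "sends_wish C R k p v" "1 < v"
  obtains e where "enters p e" "time R k = time R e + timeout C 1"
proof -
  have who: "who R k = p"
    using assms(3) by (simp add: sends_wish_def)
  have le1: "view_plus (state R p k) \<le> 1"
    using view_plus_le[OF assms(1,2)] .
  have "act R k = Timer_View_Expires"
  proof (cases "act R k")
    case Retransmit
    then show ?thesis
      using first_view_invariant[OF assms(1,2)] le1 assms(3,4)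
      by (auto simp: sends_wish_def outcome_def in_first_view_def before_entry_def Let_def
          split: if_splits)
  next
    case (Recv_Wish j u)
    then show ?thesis
      using assms(3,4) view_plus_after_wish[OF assms(1,2) who Recv_Wish] step(2)[OF assms(2) who]
      by (auto simp: sends_wish_def outcome_def on_wish_sends Let_def split: if_splits)
  qed (use assms(3,4) in \<open>auto simp: sends_wish_def outcome_def Let_def split: if_splits\<close>)
  then have timer: "timer_view (state R p k) = Some (clock R p (time R k))"
    using step(1)[OF assms(2) who] by simp
  then obtain e where e: "in_first_view p e k"
    using first_view_invariant[OF assms(1,2)] by (auto simp: before_entry_def Let_def)
  then have ent: "enters p e" "e < k"
    and "clock R p (time R k) = clock R p (time R e) + timeout C 1"
    using timer by (simp_all add: in_first_view_def Let_def)
  moreover have "GST \<le> time R e" "time R e \<le> time R k"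
    using enters_after_GST[OF ent(1)] time_mono[of e k] ent(2) by simp_all
  \<comment> \<open>Both steps lie after \<open>GST\<close>, where local clocks run at the rate of
    real time, so the local duration is a real one.\<close>
  ultimately have "time R k = time R e + timeout C 1"
    using clock_after_GST[OF assms(2), of "time R k"] clock_after_GST[OF assms(2), of "time R e"]
    by linarith
  then show ?thesis
    using that ent(1) by blast
qed

text \<open>By \<open>late_wish\<close>, the first offending wish would be sent exactly
  \<open>timeout C 1\<close> after some entry, hence after \<open>T\<close>.\<close>

lemma wishes_until_timeout:
  assumes "\<And>p e. enters p e \<Longrightarrow> T < time R e + timeout C 1"
  shows "wishes_at_most 1 (steps_by T)"
proof -
  have "wishes_at_most 1 k" if "k \<le> steps_by T" for k
    using that
  proof (induction k)
    case 0
    show ?case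
      by (simp add: wishes_at_most_def)
  next
    case (Suc k)
    then have le1: "wishes_at_most 1 k" and k: "time R k \<le> T"
      using less_steps_by[of k T] by simp_all
    have "v \<le> 1" if v: "p \<in> correct R" "sends_wish C R k p v" for p v
    proof (rule ccontr)
      assume "\<not> v \<le> 1"
      then obtain e where "enters p e" "time R k = time R e + timeout C 1"
        using late_wish[OF le1 v] by auto
      then show False
        using assms[of p e] k by simp
    qed
    then show ?case
      using le1 by (auto simp: wishes_at_most_def less_Suc_eq)
  qed
  then show ?thesis
    by simp
qed

section \<open>Deadlines for being in view 1\<close>

lemma views_after_wishes:
  assumes "\<And>p. p \<in> correct R \<Longrightarrow> \<exists>i v. 1 \<le> v \<and> sends_wish C R i p v \<and> time R i \<le> T"
    and "q \<in> correct R" "T + \<delta> \<le> T'"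
  shows "0 < view (state R q (steps_by T'))"
proof -
  have "1 \<le> max_views (state R q (steps_by T')) p" if p: "p \<in> correct R" for p
  proof -
    obtain i v where i: "1 \<le> v" "sends_wish C R i p v" "time R i \<le> T"
      using assms(1)[OF p] by blast
    have "v \<le> max_views (state R q (steps_by T')) p"
      using i assms(3) by (intro wish_delivered[OF p assms(2) i(2)] wish_after_GST[OF p i(2)]) auto
    then show ?thesis
      using i(1) by simp
  qed
  then have "correct R \<subseteq> {j \<in> procs C. 1 \<le> max_views (state R q (steps_by T')) j}"
    using correct_procs by blast
  then have "card (correct R) \<le> card {j \<in> procs C. 1 \<le> max_views (state R q (steps_by T')) j}"
    by (intro card_mono) auto
  then have "1 \<le> view (state R q (steps_by T'))"
    using card_correct unfolding le_view_iff[OF assms(2)] by linarith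
  then show ?thesis
    by simp
qed

lemma views_after_start:
  assumes "q \<in> correct R"
  shows "0 < view (state R q (steps_by (S_last R + \<delta>)))"
proof (rule views_after_wishes[OF _ assms order_refl])
  fix p
  assume p: "p \<in> correct R"
  then obtain k where k: "takes R k p Start"
    using correct_started by blast
  then obtain i v where i: "i \<le> k" "1 \<le> v" "sends_wish C R i p v"
    using started_sent[OF p] by blast
  then have "time R i \<le> S_last R"
    using time_mono start_time_bounds(2)[OF p k] order_trans by blast
  then show "\<exists>i v. 1 \<le> v \<and> sends_wish C R i p v \<and> time R i \<le> S_last R"
    using i by blast
qed

lemma views_after_entry:
  assumes "enters p e" "q \<in> correct R"
  shows "0 < view (state R q (steps_by (time R e + 2 * \<delta>)))"
proof (rule views_after_wishes[of "time R e + \<delta>", OF _ assms(2)])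
  let ?k = "steps_by (time R e + \<delta>)"
  let ?A = "{j \<in> procs C. 1 \<le> max_views (state R p (Suc e)) j}"
  have p: "p \<in> correct R" "1 \<le> view (state R p (Suc e))"
    using assms(1) by (auto simp: enters_def)
  then have "2 * max_faulty C + 1 \<le> card ?A"
    using le_view_iff by blast
  moreover have "card ?A \<le> card (?A \<inter> correct R) + card (procs C - correct R)"
    by (rule order_trans[OF card_mono card_Un_le]) auto
  \<comment> \<open>Of the \<open>2f + 1\<close> entries that made \<open>p\<close> enter, at most
    \<open>f\<close> belong to faulty processes.\<close>
  ultimately have many: "max_faulty C + 1 \<le> card (?A \<inter> correct R)"
    using card_faulty by linarith
  fix r
  assume r: "r \<in> correct R"
  have "1 \<le> max_views (state R r ?k) j" if j: "j \<in> ?A \<inter> correct R" for j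
  proof -
    let ?v = "max_views (state R p (Suc e)) j"
    have "1 \<le> ?v" "j \<in> correct R"
      using j by simp_all
    then obtain i where i: "i < Suc e" "sends_wish C R i j ?v"
      using max_views_sent[OF p(1), of j "Suc e"] by auto
    \<comment> \<open>The wish was sent no later than step \<open>e\<close>, so it reaches
      \<open>r\<close> by \<open>time R e + \<delta>\<close>.\<close>
    have "?v \<le> max_views (state R r ?k) j"
      using time_mono[of i e] i \<open>1 \<le> ?v\<close> \<open>j \<in> correct R\<close>
      by (intro wish_delivered[OF _ r i(2)] wish_after_GST[OF _ i(2)]) auto
    then show ?thesis
      using \<open>1 \<le> ?v\<close> by linarith
  qed
  then have "?A \<inter> correct R \<subseteq> {j \<in> procs C. 1 \<le> max_views (state R r ?k) j}"
    by blast
  then have "card (?A \<inter> correct R) \<le> card {j \<in> procs C. 1 \<le> max_views (state R r ?k) j}"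
    by (intro card_mono) auto
  \<comment> \<open>This makes \<open>r\<close> wish itself within the first \<delta>; the second
    \<delta> is for delivering the wishes of all correct processes.\<close>
  then have "1 \<le> view_plus (state R r ?k)"
    using many unfolding le_view_plus_iff[OF r] by linarith
  then show "\<exists>i v. 1 \<le> v \<and> sends_wish C R i r v \<and> time R i \<le> time R e + \<delta>"
    using view_plus_sent[OF r, of ?k] less_steps_by by auto
qed simp

subsection \<open>Voting in the first view\<close>

context
  assumes leader_correct: "leader C 1 \<in> correct R"
begin

text \<open>A correct process proposes only on entering a view. Under the bound on wishes the leader
  can only go from view 0 to view 1, and it has prepared nothing before. This excludes
  equivocation.\<close>

lemma leader_proposal:
  assumes "wishes_at_most 1 k" "i < k" "broadcasts C R i (leader C 1) (Propose v x u)"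
  shows "x = myval C (leader C 1)"
proof -
  let ?p = "leader C 1"
  let ?s = "state R ?p i" and ?s' = "state R ?p (Suc i)"
  let ?c = "clock R ?p (time R i)"
  have who: "who R i = ?p"
    using assms(3) by (simp add: broadcasts_def)
  obtain j w where act: "act R i = Recv_Wish j w"
    using assms(3) who
    by (cases "act R i") (auto simp: broadcasts_def outcome_def Let_def split: if_splits)
  have s': "?s' = fst (on_wish C ?p ?c j w ?s)"
    using step(2)[OF leader_correct who] act by simp
  have sent: "snd (snd (on_wish C ?p ?c j w ?s)) = Some (Propose v x u)"
    using assms(3) who act by (simp add: broadcasts_def outcome_def Let_def)
  note new = on_wish_broadcasts[OF sent, folded s']
  have "wishes_at_most 1 (Suc i)" "wishes_at_most 1 i"
    using assms(1,2) wishes_at_most_antimono by (auto simp: Suc_le_eq)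
  then have "view ?s = 0" and "prepared_view ?s = 0"
    using new(1) view_le[of 1 "Suc i" ?p] leader_correct first_view_invariant[of i ?p]
    by (auto simp: before_entry_def in_first_view_def Let_def)
  then show ?thesis
    using on_wish_new_view(7)[OF s' new(1,2,3)] sent by simp
qed

text \<open>A vote in view 1 answers a proposal authored by the leader, and authentication leaves
  only the one it really made. The same step broadcasts the matching \<open>PREPARED\<close>; its
  time is recorded to be after \<open>GST\<close> so that delivery deadlines apply.\<close>

lemma voted_first_view:
  assumes "wishes_at_most 1 k" "p \<in> correct R" "voted (state R p k) = Some True"
  defines "x \<equiv> myval C (leader C 1)"
  shows "curr_val (state R p k) = Some x \<and>
    (\<exists>i<k. broadcasts C R i p (Prepared 1 (hash C x)) \<and> GST \<le> time R i)"
  using assms(1,3)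
proof (induction k)
  case 0
  then show ?case
    using init[OF assms(2)] by (auto simp: init_state_def)
next
  case (Suc k)
  have le1: "wishes_at_most 1 k"
    using Suc.prems(1) wishes_at_most_antimono by (meson le_SucI order_refl)
  show ?case
  proof (cases "who R k = p")
    case False
    then show ?thesis
      using Suc le1 idle[OF assms(2) False] less_SucI by metis
  next
    case True
    note st = step[OF assms(2) True]
    show ?thesis
    proof (cases "\<exists>j v y u. act R k = On_Propose j v y u")
      case False
      then have "voted (state R p k) = Some True"
        "curr_val (state R p (Suc k)) = curr_val (state R p k)"
        using react_voted Suc.prems(2) unfolding st(2) by blast+
      then show ?thesis
        using Suc.IH[OF le1] less_SucI by metis
    next
      case True
      then obtain j v y u where act: "act R k = On_Propose j v y u"
        by blast
      then have en: "(j, Propose v y u) \<in> received (state R p k)" "curr_view (state R p k) = v"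
        "voted (state R p k) = Some False" "j = leader C v"
        using st(1) by (auto simp: safe_proposal_def)
      obtain e where e: "in_first_view p e k"
        using voted_in_first_view[OF le1 assms(2)] en(3) by auto
      then have "v = 1" "enters p e" "e < k"
        using en(2) by (auto simp: in_first_view_def Let_def)
      then have "y = x"
        using received_broadcast[OF assms(2) leader_correct] en leader_proposal[OF le1]
        unfolding x_def by blast
      moreover have "GST \<le> time R k"
        using enters_after_GST[OF \<open>enters p e\<close>] time_mono[of e k] \<open>e < k\<close> by simp
      ultimately show ?thesis
        using st(2) act \<open>who R k = p\<close> \<open>v = 1\<close>
        by (auto simp: broadcasts_def outcome_def intro!: exI[of _ k])
    qed
  qed
qed

text \<open>A further run of the \<open>PREPARED\<close> handler can only lock the current view,
  which is 1 again.\<close>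

lemma locked_mono:
  assumes "p \<in> correct R" "i \<le> k" "wishes_at_most 1 k" "locked_view (state R p i) = 1"
  shows "locked_view (state R p k) = 1"
  using assms(2,3)
proof (induction k rule: dec_induct)
  case (step k)
  then have le1: "wishes_at_most 1 k"
    using wishes_at_most_antimono by (meson le_SucI order_refl)
  show ?case
  proof (cases "who R k = p")
    case False
    then show ?thesis
      using step.IH[OF le1] idle[OF assms(1)] by simp
  next
    case True
    note st = tendermint_run.step[OF tendermint_run_axioms assms(1) True]
    have "v = 1" if act: "act R k = On_Prepared v h" for v h
    proof -
      have "voted (state R p k) \<noteq> None" "curr_view (state R p k) = v"
        using st(1) act by simp_all
      then show ?thesis
        using voted_in_first_view[OF le1 assms(1)] by (auto simp: in_first_view_def Let_def)
    qed
    then show ?thesis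
      using step.IH[OF le1] unfolding st(2) react_locked_view by (auto split: action.split)
  qed
qed (use assms(4) in simp)

text \<open>By contradiction: at the cut-off a process without a vote would have the leader's
  proposal and an enabled handler, so the handler has run, while the invariant says that it has
  not.\<close>

lemma all_vote:
  assumes "\<And>q. q \<in> correct R \<Longrightarrow> 0 < view (state R q (steps_by T))"
    and "wishes_at_most 1 (steps_by (T + \<Theta>))" "p \<in> correct R"
  shows "voted (state R p (steps_by (T + \<Theta>))) = Some True"
proof (rule ccontr)
  let ?p = "leader C 1" and ?k = "steps_by (T + \<Theta>)"
  let ?x = "myval C ?p"
  assume not_voted: "voted (state R p ?k) \<noteq> Some True"
  have le: "steps_by T \<le> ?k"
    using delay_nonneg by (intro steps_by_mono) simp
  have in_view: "0 < view (state R p ?k)"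
    using assms(1)[OF assms(3)] view_mono[OF assms(3) le] by linarith
  obtain e where e: "in_first_view p e ?k"
    and none: "\<And>i j v x u. voted (state R p ?k) = Some False \<Longrightarrow> i < ?k \<Longrightarrow>
      \<not> takes R i p (On_Propose j v x u)"
    using first_view_invariant[OF assms(2,3)] in_view by (auto simp: before_entry_def Let_def)
  then have fresh: "voted (state R p ?k) = Some False" "locked_view (state R p ?k) = 0"
    "curr_view (state R p ?k) = 1"
    using not_voted by (auto simp: in_first_view_def Let_def)
  have leW: "wishes_at_most 1 (steps_by T)"
    using assms(2) le wishes_at_most_antimono by blast
  obtain e' where "in_first_view ?p e' (steps_by T)"
    using in_first_viewI[OF leW leader_correct assms(1)[OF leader_correct]] by blast
  then have e': "e' < steps_by T" "enters ?p e'" "broadcasts C R e' ?p (Propose 1 ?x 0)"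
    by (simp_all add: in_first_view_def Let_def)
  have "(?p, Propose 1 ?x 0) \<in> received (state R p ?k)"
    using e'(1) by (intro broadcast_delivered[OF leader_correct assms(3) e'(3)]
        enters_after_GST[OF e'(2)]) (simp add: less_steps_by)
  moreover have "valid C ?x"
    using run leader_correct by (simp add: tendermint_fastsync_run_def)
  \<comment> \<open>As \<open>locked_view\<close> is 0, \<open>safe_proposal\<close> asks only for
    the right leader and a valid value.\<close>
  ultimately have en: "enabled C c (state R p ?k) (On_Propose ?p 1 ?x 0)" for c
    using fresh by (simp add: safe_proposal_def)
  have "time R 0 \<le> T + \<Theta>"
    using e'(1) time_mono[of 0 e'] delay_nonneg by (simp add: less_steps_by)
  then obtain i where "time R i \<le> T + \<Theta>" "takes R i p (On_Propose ?p 1 ?x 0)"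
    using handler_ran[OF assms(3) _ _ en] by auto
  then show False
    using none fresh(1) less_steps_by by blast
qed

section \<open>Locking and deciding\<close>

lemma all_lock:
  assumes all_in: "\<And>q. q \<in> correct R \<Longrightarrow> 0 < view (state R q (steps_by T))"
    and W: "wishes_at_most 1 (steps_by (T + 2 * \<Theta>))"
    and lock: "\<And>q e. enters q e \<Longrightarrow> T + 2 * \<Theta> < time R e + lock_timeout C 1"
    and p: "p \<in> correct R"
  defines "x \<equiv> myval C (leader C 1)"
  shows "locked_view (state R p (steps_by (T + 2 * \<Theta>))) = 1 \<and>
    (\<exists>i<steps_by (T + 2 * \<Theta>). broadcasts C R i p (Committed 1 (hash C x)) \<and> GST \<le> time R i)"
proof -
  let ?k1 = "steps_by (T + \<Theta>)" and ?k = "steps_by (T + 2 * \<Theta>)"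
  have le: "steps_by T \<le> ?k1" "?k1 \<le> ?k"
    using delay_nonneg by (auto intro: steps_by_mono)
  have W1: "wishes_at_most 1 ?k1"
    using W le(2) wishes_at_most_antimono by blast
  have in1: "0 < view (state R q ?k1)" if "q \<in> correct R" for q
    using all_in[OF that] view_mono[OF that le(1)] by linarith
  have received: "(q, Prepared 1 (hash C x)) \<in> received (state R p ?k)" if q: "q \<in> correct R" for q
  proof -
    obtain i where i: "i < ?k1" "broadcasts C R i q (Prepared 1 (hash C x))" "GST \<le> time R i"
      using voted_first_view[OF W1 q all_vote[OF all_in W1 q]] unfolding x_def by blast
    then show ?thesis
      by (intro broadcast_delivered[OF q p i(2,3)]) (simp add: less_steps_by)
  qed
  have eq: "T + \<Theta> + \<Theta> = T + 2 * \<Theta>"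
    by simp
  \<comment> \<open>\<open>all_vote\<close> with \<open>T + \<Theta>\<close> in place of
    \<open>T\<close> gives the vote at the later cut-off.\<close>
  have voted: "voted (state R p ?k) = Some True"
    using all_vote[OF in1 _ p, unfolded eq] W by blast
  then have "curr_val (state R p ?k) = Some x"
    using voted_first_view[OF W p] unfolding x_def by blast
  moreover have "curr_view (state R p ?k) = 1"
    using voted_in_first_view[OF W p] voted by (auto simp: in_first_view_def Let_def)
  ultimately have en: "enabled C c (state R p ?k) (On_Prepared 1 (hash C x))" for c
    using voted received_from_quorumI[OF received] by simp
  \<comment> \<open>An entry step shows that the run has begun by the cut-off, as
    \<open>handler_ran\<close> requires.\<close>
  obtain e0 where "e0 < steps_by T" "enters p e0"
    using entered[OF p all_in[OF p]] by blast
  then have "time R 0 \<le> T + 2 * \<Theta>"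
    using time_mono[of 0 e0] delay_nonneg by (simp add: less_steps_by)
  then obtain i where i: "time R i \<le> T + 2 * \<Theta>" "takes R i p (On_Prepared 1 (hash C x))"
    using handler_ran[OF p _ _ en] by auto
  then have who: "who R i = p" and act: "act R i = On_Prepared 1 (hash C x)"
    by (simp_all add: takes_def)
  have "i < ?k"
    using i(1) by (simp add: less_steps_by)
  then have Wi: "wishes_at_most 1 i"
    using W wishes_at_most_antimono by simp
  \<comment> \<open>The handler may have run well before the cut-off, so the lock timer has to be
    examined in the state at step \<open>i\<close>.\<close>
  have "voted (state R p i) \<noteq> None"
    using step(1)[OF p who] act by simp
  then obtain e where "in_first_view p e i"
    using voted_in_first_view[OF Wi p] by blast
  then have e: "e < i" "enters p e"
    "timer_lock (state R p i) = Some (clock R p (time R e) + lock_timeout C 1)"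
    by (simp_all add: in_first_view_def Let_def)
  have GST: "GST \<le> time R e" "GST \<le> time R i"
    using enters_after_GST[OF e(2)] time_mono[of e i] e(1) by simp_all
  have "clock R p (time R i) < clock R p (time R e) + lock_timeout C 1"
    using clock_after_GST[OF p GST(1)] clock_after_GST[OF p GST(2)] lock[OF e(2)] i(1) by linarith
  then have "\<not> timer_lock_expired (clock R p (time R i)) (state R p i)"
    using e(3) by (simp add: timer_lock_expired_def)
  then have "locked_view (state R p (Suc i)) = 1" "broadcasts C R i p (Committed 1 (hash C x))"
    using step(2)[OF p who] act who by (simp_all add: broadcasts_def outcome_def Let_def)
  then show ?thesis
    using locked_mono[OF p _ W] \<open>i < ?k\<close> GST(2) by (meson Suc_leI)
qed

text \<open>All \<open>COMMITTED\<close> messages are out by \<open>T + 2 * \<Theta>\<close> and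
  delivered one \<open>\<Theta>\<close> later; the lock, the vote and the view persist until
  then.\<close>

lemma all_decide:
  assumes all_in: "\<And>q. q \<in> correct R \<Longrightarrow> 0 < view (state R q (steps_by T))"
    and W: "wishes_at_most 1 (steps_by (T + 3 * \<Theta>))"
    and lock: "\<And>q e. enters q e \<Longrightarrow> T + 2 * \<Theta> < time R e + lock_timeout C 1"
    and p: "p \<in> correct R"
  shows "\<exists>x t. t \<le> T + 3 * \<Theta> \<and> decides_at R p x t"
proof -
  let ?k2 = "steps_by (T + 2 * \<Theta>)" and ?k = "steps_by (T + 3 * \<Theta>)"
  define x where "x = myval C (leader C 1)"
  have le: "steps_by T \<le> ?k2" "?k2 \<le> ?k"
    using delay_nonneg by (auto intro: steps_by_mono)
  have W2: "wishes_at_most 1 ?k2"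
    using W le(2) wishes_at_most_antimono by blast
  have committed: "locked_view (state R q ?k2) = 1 \<and>
      (\<exists>i<?k2. broadcasts C R i q (Committed 1 (hash C x)) \<and> GST \<le> time R i)"
    if "q \<in> correct R" for q
    unfolding x_def by (rule all_lock[OF all_in W2 lock that])
  have "(q, Committed 1 (hash C x)) \<in> received (state R p ?k)" if q: "q \<in> correct R" for q
  proof -
    obtain i where i: "i < ?k2" "broadcasts C R i q (Committed 1 (hash C x))" "GST \<le> time R i"
      using committed[OF q] by blast
    then show ?thesis
      by (intro broadcast_delivered[OF q p i(2,3)]) (simp add: less_steps_by)
  qed
  then have received: "received_from_quorum C (state R p ?k) (Committed 1 (hash C x))"
    by (rule received_from_quorumI)
  have in2: "0 < view (state R q ?k2)" if "q \<in> correct R" for q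
    using all_in[OF that] view_mono[OF that le(1)] by linarith
  have eq: "T + 2 * \<Theta> + \<Theta> = T + 3 * \<Theta>"
    by simp
  have voted: "voted (state R p ?k) = Some True"
    using all_vote[OF in2 _ p, unfolded eq] W by blast
  then have "curr_val (state R p ?k) = Some x"
    using voted_first_view[OF W p] unfolding x_def by blast
  moreover have "curr_view (state R p ?k) = 1"
    using voted_in_first_view[OF W p] voted by (auto simp: in_first_view_def Let_def)
  moreover have "locked_view (state R p ?k) = 1"
    using locked_mono[OF p le(2) W] committed[OF p] by blast
  ultimately have en: "enabled C c (state R p ?k) (On_Committed 1 (hash C x))" for c
    using received by simp
  obtain e0 where "e0 < steps_by T" "enters p e0"
    using entered[OF p all_in[OF p]] by blast
  then have "time R 0 \<le> T + 3 * \<Theta>"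
    using time_mono[of 0 e0] delay_nonneg by (simp add: less_steps_by)
  then obtain i where i: "time R i \<le> T + 3 * \<Theta>" "takes R i p (On_Committed 1 (hash C x))"
    using handler_ran[OF p _ _ en] by auto
  \<comment> \<open>The value decided is read at step \<open>i\<close>, where the precondition on
    the hash ensures that \<open>curr_val\<close> is set.\<close>
  then have "\<exists>y. curr_val (state R p i) = Some y"
    using step(1)[OF p, of i] by (auto simp: takes_def)
  then show ?thesis
    using i unfolding decides_at_def by blast
qed

lemma decision_time:
  assumes "2 * \<delta> + 2 * \<Theta> < lock_timeout C 1" "2 * \<delta> + 3 * \<Theta> < timeout C 1"
    and p: "p \<in> correct R"
  shows "\<exists>x t. t \<le> S_last R + \<delta> + 3 * \<Theta> \<and> decides_at R p x t"
proof -
  \<comment> \<open>The first entry of any correct process: every timer of view 1 starts at this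
    time or later.\<close>
  define e where "e = (LEAST e. \<exists>q. enters q e)"
  obtain e' where e': "e' < steps_by (S_last R + \<delta>)" "enters p e'"
    using entered[OF p views_after_start[OF p]] by blast
  then have "\<exists>q. enters q e"
    unfolding e_def by (intro LeastI) blast
  then obtain q where e: "enters q e"
    by blast
  have first: "time R e \<le> time R i" if "enters r i" for r i
    using that unfolding e_def by (intro time_mono Least_le) blast
  \<comment> \<open>Both times are deadlines for all to be in view 1. The first keeps the three
    rounds within the timeouts, the second gives the bound on the decision time.\<close>
  define T where "T = min (time R e + 2 * \<delta>) (S_last R + \<delta>)"
  have "0 < view (state R r (steps_by T))" if "r \<in> correct R" for r
    using views_after_entry[OF e that] views_after_start[OF that] unfolding T_def min_def by simp
  moreover have "T + 3 * \<Theta> < time R i + timeout C 1" "T + 2 * \<Theta> < time R i + lock_timeout C 1"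
    if "enters r i" for r i
    using first[OF that] assms(1,2) unfolding T_def by linarith+
  ultimately have "\<exists>x t. t \<le> T + 3 * \<Theta> \<and> decides_at R p x t"
    by (intro all_decide p wishes_until_timeout)
  moreover have "T + 3 * \<Theta> \<le> S_last R + \<delta> + 3 * \<Theta>"
    unfolding T_def by simp
  ultimately show ?thesis
    using order_trans by blast
qed

end

end

theorem corollary75:
  fixes C :: "('v, 'h) config" and R :: "('v, 'h) run"
    and GST \<delta> \<Theta> :: real
  assumes "wf_config C"
    and "tendermint_fastsync_run C R"
    and "partial_synchrony C R GST \<delta>"
    and "reliable_broadcast C R GST \<Theta>"
    and "S_first R \<ge> GST"
    and "lock_timeout C 1 > 2 * \<delta> + 2 * \<Theta>"
    and "timeout C 1 > 2 * \<delta> + 3 * \<Theta>"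
    and "leader C 1 \<in> correct R"
  shows "\<forall>p\<in>correct R. \<exists>x t. t \<le> S_last R + \<delta> + 3 * \<Theta> \<and> decides_at R p x t"
proof -
  interpret tendermint_run C R GST \<delta> \<Theta>
    using assms(2-5) by unfold_locales
  show ?thesis
    using decision_time assms(6-8) by blast
qed

end
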